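(* Let $M$ be a left-cancellative monoid with no nontrivial invertible element and let $S$ be a Garside family in $M$. Then the normalisation $(S,N)$ derived from $S$ is quadratic of class $(4,3)$.
   Context: For $f,g\in M$, $f\preccurlyeq g$ means $fg'=g$ for some $g'\in M$. For $S\subseteq M$, a word $s_1|s_2$ over $S$ is $S$-normal if for all $s\in S$ and $f\in M$, $s\preccurlyeq f s_1s_2$ implies $s\preccurlyeq f s_1$; a word $s_1|\cdots|s_p$ is $S$-normal if every $s_i|s_{i+1}$ is $S$-normal. For $M$ with no nontrivial invertible element and $1\in S\subseteq M$, $S$ is a Garside family in $M$ if every $g\in M$ equals $s_1\cdots s_p$ for some $S$-normal word $s_1|\cdots|s_p$ (an $S$-normal decomposition of $g$). Known facts: each $g\in M$ has a unique $S$-normal decomposition $\mathrm{NF}(g)$ of minimal length, whose letters lie in $S\setminus\{1\}$; any two $S$-normal decompositions of the same element differ only by appending final entries $1$; and if $g$ is represented by a word of length $p$ over $S$ then $\mathrm{NF}(g)$ has length at most $p$. The normalisation derived from $S$ is the pair $(S,N)$ with $N:S^*\to S^*$, $N(w)=\mathrm{NF}(g)|1^m$, where $g\in M$ is the evaluation (product) of $w$, $m=\|w\|-\|\mathrm{NF}(g)\|$, $\|\cdot\|$ is word length and $|$ is concatenation (here $1\in S$ is used as a letter). $S^{[p]}$ is the set of words of length $p$. A normalisation is a pair $(S,N)$ with $N:S^*\to S^*$ such that for all words $u,v,w$: $\|N(w)\|=\|w\|$; $\|w\|=1$ implies $N(w)=w$; $N(u|N(w)|v)=N(u|w|v)$.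 A word is $N$-normal if $N(w)=w$. $\overline{N}$ is the restriction of $N$ to $S^{[2]}$; $\overline{N}_i$ applies $\overline{N}$ to the entries in positions $i,i+1$; $\overline{N}_{i_1\cdots i_n}=\overline{N}_{i_n}\circ\cdots\circ\overline{N}_{i_1}$. $(S,N)$ is quadratic if (a) a word is $N$-normal iff each of its length-two factors is, and (b) for every word $w$ there is a finite sequence $u$ of positions with $N(w)=\overline{N}_u(w)$. It is of class $(4,3)$ if $N(w)=\overline{N}_{1212}(w)=\overline{N}_{212}(w)$ for all $w\in S^{[3]}$. *)

theory Defs
  imports Main
begin

text \<open>
  The monoid is the type; words over S are the members of \<^term>\<open>lists S\<close>, and a map on words over
  S is a function on all lists whose values outside \<^term>\<open>lists S\<close> are irrelevant.
\<close>

definition left_dvd :: "'a::monoid_mult \<Rightarrow> 'a \<Rightarrow> bool"  (infix "\<preceq>\<^sub>l" 50) where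
  "f \<preceq>\<^sub>l g \<longleftrightarrow> (\<exists>g'. f * g' = g)"

definition normal_pair :: "'a::monoid_mult set \<Rightarrow> 'a \<Rightarrow> 'a \<Rightarrow> bool" where
  "normal_pair S s1 s2 \<longleftrightarrow> (\<forall>s\<in>S. \<forall>f. s \<preceq>\<^sub>l f * s1 * s2 \<longrightarrow> s \<preceq>\<^sub>l f * s1)"

definition normal_word :: "'a::monoid_mult set \<Rightarrow> 'a list \<Rightarrow> bool" where
  "normal_word S w \<longleftrightarrow> w \<in> lists S \<and> successively (normal_pair S) w"

definition normal_decomp :: "'a::monoid_mult set \<Rightarrow> 'a \<Rightarrow> 'a list \<Rightarrow> bool" where
  "normal_decomp S g w \<longleftrightarrow> normal_word S w \<and> prod_list w = g"

text \<open>This notion is meant for monoids without nontrivial invertible elements.\<close>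

definition garside_family :: "'a::monoid_mult set \<Rightarrow> bool" where
  "garside_family S \<longleftrightarrow> 1 \<in> S \<and> (\<forall>g. \<exists>w. normal_decomp S g w)"

definition NF :: "'a::monoid_mult set \<Rightarrow> 'a \<Rightarrow> 'a list" where
  "NF S g = (THE w. normal_decomp S g w \<and> (\<forall>v. normal_decomp S g v \<longrightarrow> length w \<le> length v))"

text \<open>
  When S is a Garside family in a left-cancellative monoid without nontrivial invertible elements,
  the normal form of the value of a word over S is never longer than the word, so the subtraction
  below does not truncate.
\<close>

definition derived_normalisation :: "'a::monoid_mult set \<Rightarrow> 'a list \<Rightarrow> 'a list" where
  "derived_normalisation S w =
     (let v = NF S (prod_list w) in v @ replicate (length w - length v) 1)"

definition normalisation :: "'a set \<Rightarrow> ('a list \<Rightarrow> 'a list) \<Rightarrow> bool" where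
  "normalisation S N \<longleftrightarrow>
     (\<forall>w\<in>lists S. N w \<in> lists S) \<and>
     (\<forall>w\<in>lists S. length (N w) = length w) \<and>
     (\<forall>w\<in>lists S. length w = 1 \<longrightarrow> N w = w) \<and>
     (\<forall>u\<in>lists S. \<forall>v\<in>lists S. \<forall>w\<in>lists S. N (u @ N w @ v) = N (u @ w @ v))"

text \<open>
  Positions are counted from 1, and \<^term>\<open>apply_at N i w\<close> is meaningful only for
  \<^prop>\<open>1 \<le> i \<and> i < length w\<close>.
\<close>

definition apply_at :: "('a list \<Rightarrow> 'a list) \<Rightarrow> nat \<Rightarrow> 'a list \<Rightarrow> 'a list" where
  "apply_at N i w = take (i - 1) w @ N [w ! (i - 1), w ! i] @ drop (i + 1) w"

text \<open>The leftmost position in the sequence is treated first.\<close>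

definition apply_seq :: "('a list \<Rightarrow> 'a list) \<Rightarrow> nat list \<Rightarrow> 'a list \<Rightarrow> 'a list" where
  "apply_seq N is w = fold (apply_at N) is w"

definition quadratic :: "'a set \<Rightarrow> ('a list \<Rightarrow> 'a list) \<Rightarrow> bool" where
  "quadratic S N \<longleftrightarrow>
     (\<forall>w\<in>lists S. N w = w \<longleftrightarrow> (\<forall>x y z. w = x @ y @ z \<and> length y = 2 \<longrightarrow> N y = y)) \<and>
     (\<forall>w\<in>lists S. \<exists>is. set is \<subseteq> {1..<length w} \<and> N w = apply_seq N is w)"

definition class_4_3 :: "'a set \<Rightarrow> ('a list \<Rightarrow> 'a list) \<Rightarrow> bool" where
  "class_4_3 S N \<longleftrightarrow>
     (\<forall>w\<in>lists S. length w = 3 \<longrightarrow>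
        N w = apply_seq N [1, 2, 1, 2] w \<and> N w = apply_seq N [2, 1, 2] w)"

end

theory Submission imports Defs
begin

text \<open>
  Because of the factor f in the definition of a normal pair, a word \<open>t\<^sub>1|\<dots>|t\<^sub>p\<close> over S can be
  compared letter by letter with a normal word of the same value: the elements \<open>f\<^sub>i\<close> with
  \<open>t\<^sub>1\<dots>t\<^sub>i f\<^sub>i = s\<^sub>1\<dots>s\<^sub>i\<close> exist, and left cancellation shows that \<open>s\<^sub>i = 1\<close> for \<open>i > p\<close>. So N maps
  w to the only normal word having the value and the length of w. The same factor f yields the
  domino rule: if \<open>b|c\<close> and \<open>x|y\<close> are normal, \<open>ab = xy\<close> and \<open>yc = x'y'\<close>, then \<open>x|x'\<close> is normal.
  Hence one left-to-right pass of the restriction of N to pairs normalises a letter followed by a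
  normal word; for words of length three this is the class (4,3) identity.
\<close>

section \<open>Normal words\<close>

lemma normal_pair_one_right: "normal_pair S s 1"
  by (simp add: normal_pair_def)

lemma normal_word_Nil [simp]: "normal_word S []"
  by (simp add: normal_word_def)

lemma normal_word_singleton [simp]: "normal_word S [s] \<longleftrightarrow> s \<in> S"
  by (simp add: normal_word_def)

lemma normal_word_Cons2 [simp]:
  "normal_word S (s # t # w) \<longleftrightarrow> s \<in> S \<and> normal_pair S s t \<and> normal_word S (t # w)"
  by (auto simp: normal_word_def)

lemma normal_word_ConsD: "normal_word S (s # w) \<Longrightarrow> s \<in> S \<and> normal_word S w"
  by (cases w) auto

lemma normal_word_letters: "normal_word S w \<Longrightarrow> w \<in> lists S"
  by (simp add: normal_word_def)

lemma normal_word_take: "normal_word S w \<Longrightarrow> normal_word S (take n w)"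
  unfolding normal_word_def
  by (metis append_take_drop_id append_in_lists_conv successively_append_iff)

lemma normal_word_pad:
  assumes "1 \<in> S" and "normal_word S w"
  shows "normal_word S (w @ replicate n 1)"
proof -
  have "successively (normal_pair S) (replicate n 1)"
    by (simp add: successively_conv_nth normal_pair_one_right)
  then show ?thesis
    using assms by (cases n) (auto simp: normal_word_def successively_append_iff
        normal_pair_one_right in_lists_conv_set)
qed

text \<open>Puts \<open>successively\<close> into the shape of the factor condition in
  \<open>quadratic\<close>.\<close>

lemma successively_iff_factors:
  "successively P w \<longleftrightarrow> (\<forall>x a b z. w = x @ [a, b] @ z \<longrightarrow> P a b)"
proof (induction w rule: induct_list012)
  case (3 a b w)
  show ?case
  proof
    assume "successively P (a # b # w)"
    then show "\<forall>x c d z. a # b # w = x @ [c, d] @ z \<longrightarrow> P c d"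
      by (metis successively.simps(3) successively_append_iff append_Cons append_Nil)
  next
    assume *: "\<forall>x c d z. a # b # w = x @ [c, d] @ z \<longrightarrow> P c d"
    then have "P a b" by (metis append_Cons append_Nil)
    moreover have "successively P (b # w)"
      using * "3.IH"(2) by (metis append_Cons)
    ultimately show "successively P (a # b # w)" by simp
  qed
qed auto

text \<open>Moving \<open>t\<close> into the left factor turns the claim for the tail
  \<open>u # w\<close> into divisibility of \<open>f * t * u\<close> by \<open>s\<close>; one use of
  the normal pair \<open>t\<close>, \<open>u\<close> then removes \<open>u\<close>.\<close>

lemma normal_word_head_absorbs:
  assumes "normal_word S (t # w)" and "s \<in> S" and "s \<preceq>\<^sub>l f * prod_list (t # w)"
  shows "s \<preceq>\<^sub>l f * t"
  using assms
proof (induction w arbitrary: t f)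
  case Nil
  then show ?case by simp
next
  case (Cons u w)
  have "normal_word S (u # w)" and tu: "normal_pair S t u"
    using Cons.prems(1) by simp_all
  moreover have "s \<preceq>\<^sub>l (f * t) * prod_list (u # w)"
    using Cons.prems(3) by (simp add: mult.assoc)
  ultimately have "s \<preceq>\<^sub>l f * t * u"
    using Cons.IH Cons.prems(2) by blast
  with tu show ?case
    using Cons.prems(2) unfolding normal_pair_def by blast
qed

text \<open>Multiplying \<open>f * x * x'\<close> on the right by \<open>y'\<close> gives
  \<open>f * a * b * c\<close>. The pair \<open>b\<close>, \<open>c\<close> removes
  \<open>c\<close>, what is left equals \<open>f * x * y\<close>, and the pair \<open>x\<close>,
  \<open>y\<close> removes \<open>y\<close>.\<close>

lemma normal_pair_domino:
  fixes a b c x y x' y' :: "'a::monoid_mult"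
  assumes bc: "normal_pair S b c" and xy: "normal_pair S x y"
    and eq: "a * b = x * y" and eq': "y * c = x' * y'"
  shows "normal_pair S x x'"
  unfolding normal_pair_def
proof (intro ballI allI impI)
  fix s f assume s: "s \<in> S" and "s \<preceq>\<^sub>l f * x * x'"
  then have "s \<preceq>\<^sub>l f * x * x' * y'"
    unfolding left_dvd_def by (metis mult.assoc)
  also have "f * x * x' * y' = f * ((x * y) * c)"
    using eq' by (simp add: mult.assoc)
  also have "\<dots> = f * ((a * b) * c)"
    by (simp only: eq)
  also have "\<dots> = f * a * b * c"
    by (simp only: mult.assoc)
  finally have "s \<preceq>\<^sub>l f * a * b"
    using bc s by (auto simp: normal_pair_def)
  then have "s \<preceq>\<^sub>l f * x * y"
    using eq by (simp add: mult.assoc)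
  then show "s \<preceq>\<^sub>l f * x"
    using xy s by (auto simp: normal_pair_def)
qed

section \<open>Rewriting length-two factors\<close>

lemma apply_at_1: "apply_at N (Suc 0) (a # b # w) = N [a, b] @ w"
  by (simp add: apply_at_def)

lemma apply_at_Suc_Cons: "1 \<le> i \<Longrightarrow> apply_at N (Suc i) (a # w) = a # apply_at N i w"
  by (cases i) (auto simp: apply_at_def)

lemma apply_seq_Nil: "apply_seq N [] w = w"
  by (simp add: apply_seq_def)

lemma apply_seq_Cons: "apply_seq N (i # is) w = apply_seq N is (apply_at N i w)"
  by (simp add: apply_seq_def)

lemma apply_seq_append: "apply_seq N (is @ js) w = apply_seq N js (apply_seq N is w)"
  by (simp add: apply_seq_def)

text \<open>Shifted positions leave the head alone. Position 0 is excluded because it would shift to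
  1, where rewriting touches \<open>a\<close>.\<close>

lemma apply_seq_map_Suc:
  "set is \<subseteq> {1..} \<Longrightarrow> apply_seq N (map Suc is) (a # w) = a # apply_seq N is w"
  by (induction "is" arbitrary: w) (auto simp: apply_seq_Nil apply_seq_Cons apply_at_Suc_Cons)

text \<open>Recursive form of the pass through positions 1, 2, and so on: the letter
  \<open>a\<close> travels rightwards, and each normalised pair leaves its first entry behind and
  sends its second one on. This suits induction on the word with \<open>a\<close> arbitrary.\<close>

fun domino_pass :: "('a list \<Rightarrow> 'a list) \<Rightarrow> 'a \<Rightarrow> 'a list \<Rightarrow> 'a list" where
  "domino_pass N a [] = [a]"
| "domino_pass N a (s # w) = hd (N [a, s]) # domino_pass N (last (N [a, s])) w"

section \<open>The normalisation derived from a Garside family\<close>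

locale garside =
  fixes S :: "'a::monoid_mult set"
  assumes left_cancellative: "(a::'a) * b = a * c \<Longrightarrow> b = c"
    and no_invertible: "(a::'a) * b = 1 \<Longrightarrow> b * a = 1 \<Longrightarrow> a = 1"
    and garside_family: "garside_family S"
begin

abbreviation N where "N \<equiv> derived_normalisation S"

section \<open>Invertibility, uniqueness and length of normal words\<close>

lemma one_mem: "1 \<in> S"
  using garside_family by (simp add: garside_family_def)

text \<open>Left cancellation makes a right inverse two-sided:
  \<open>a * (b * a) = (a * b) * a = a * 1\<close>.\<close>

lemma mult_eq_oneD:
  fixes a b :: 'a
  assumes "a * b = 1" shows "a = 1" "b = 1"
proof -
  have "a * (b * a) = a * 1"
    using assms by (simp add: mult.assoc [symmetric])
  then have "b * a = 1" by (rule left_cancellative)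
  with assms show "a = 1" "b = 1" using no_invertible by blast+
qed

lemma left_dvd_antisym:
  fixes a b :: 'a
  assumes "a \<preceq>\<^sub>l b" and "b \<preceq>\<^sub>l a" shows "a = b"
proof -
  from assms obtain c d where cd: "a * c = b" "b * d = a"
    by (auto simp: left_dvd_def)
  then have "a * (c * d) = a * 1" by (simp add: mult.assoc [symmetric])
  then have "c * d = 1" by (rule left_cancellative)
  then have "c = 1" by (rule mult_eq_oneD)
  with cd show ?thesis by simp
qed

text \<open>By head absorption with \<open>f = 1\<close>, the two heads divide each other, hence
  agree and can be cancelled. Equal lengths rule out padding by 1.\<close>

lemma normal_word_unique:
  assumes "normal_word S v" and "normal_word S w"
    and "length v = length w" and "prod_list v = prod_list w"
  shows "v = w"
  using assms(3,1,2,4)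
proof (induction v w rule: list_induct2)
  case Nil
  then show ?case by simp
next
  case (Cons s v t w)
  have mem: "s \<in> S" "t \<in> S" and normal: "normal_word S v" "normal_word S w"
    using Cons.prems normal_word_ConsD by blast+
  have eq: "s * prod_list v = t * prod_list w"
    using Cons.prems by simp
  have "s \<preceq>\<^sub>l 1 * prod_list (t # w)"
    unfolding left_dvd_def by (intro exI [of _ "prod_list v"]) (simp add: eq)
  then have "s \<preceq>\<^sub>l t"
    using normal_word_head_absorbs [of S t w s 1] Cons.prems(2) mem by simp
  moreover have "t \<preceq>\<^sub>l 1 * prod_list (s # v)"
    unfolding left_dvd_def by (intro exI [of _ "prod_list w"]) (simp add: eq)
  then have "t \<preceq>\<^sub>l s"
    using normal_word_head_absorbs [of S s v t 1] Cons.prems(1) mem by simp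
  ultimately have "s = t" by (rule left_dvd_antisym)
  with eq have "prod_list v = prod_list w"
    using left_cancellative by blast
  with \<open>s = t\<close> Cons.IH normal show ?case by simp
qed

text \<open>The factor \<open>f\<close> serves the induction: it starts as 1, and each letter
  \<open>a\<close> of \<open>t\<close> replaces it by the quotient \<open>g\<close> with
  \<open>a * g = f * s\<close>. Once \<open>t\<close> is exhausted, \<open>f\<close> times the
  remaining product is 1, so that product is 1.\<close>

lemma normal_word_excess:
  assumes "t \<in> lists S" and "normal_word S v" and "f * prod_list v = prod_list t"
  shows "prod_list (drop (length t) v) = 1"
  using assms
proof (induction t arbitrary: f v)
  case Nil
  then show ?case using mult_eq_oneD(2) [of f "prod_list v"] by simp
next
  case (Cons a t)
  then have "a \<in> S" and t: "t \<in> lists S" by auto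
  show ?case
  proof (cases v)
    case Nil
    then show ?thesis by simp
  next
    case v: (Cons s u)
    with Cons.prems have su: "normal_word S (s # u)" and eq: "f * prod_list (s # u) = a * prod_list t"
      by simp_all
    then have "a \<preceq>\<^sub>l f * prod_list (s # u)"
      by (metis left_dvd_def)
    then have "a \<preceq>\<^sub>l f * s"
      using normal_word_head_absorbs su \<open>a \<in> S\<close> by blast
    then obtain g where g: "a * g = f * s"
      by (auto simp: left_dvd_def)
    have "a * (g * prod_list u) = (a * g) * prod_list u"
      by (simp only: mult.assoc)
    also have "\<dots> = a * prod_list t"
      using eq by (simp add: g mult.assoc)
    finally have "g * prod_list u = prod_list t" by (rule left_cancellative)
    moreover have "normal_word S u" using su normal_word_ConsD by blast
    ultimately have "prod_list (drop (length t) u) = 1"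
      using Cons.IH t by blast
    with v show ?thesis by simp
  qed
qed

text \<open>Any normal decomposition can be cut off at the length of \<open>w\<close>, since the
  letters beyond have product 1.\<close>

lemma normal_decomp_short_exists:
  assumes "w \<in> lists S"
  shows "\<exists>v. normal_decomp S (prod_list w) v \<and> length v \<le> length w"
proof -
  obtain v where v: "normal_word S v" "prod_list v = prod_list w"
    using garside_family by (auto simp: garside_family_def normal_decomp_def)
  have "prod_list (drop (length w) v) = 1"
    using normal_word_excess [of w v 1] assms v by simp
  then have "prod_list (take (length w) v) = prod_list v"
    by (metis append_take_drop_id mult_1_right prod_list.append)
  with v show ?thesis
    by (intro exI [of _ "take (length w) v"]) (auto simp: normal_decomp_def normal_word_take)
qed

section \<open>Minimal normal forms and the map \<open>N\<close>\<close>

lemma NF_minimal: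
  "normal_decomp S g (NF S g) \<and> (\<forall>v. normal_decomp S g v \<longrightarrow> length (NF S g) \<le> length v)"
  unfolding NF_def
proof (rule theI')
  let ?P = "\<lambda>w. normal_decomp S g w \<and> (\<forall>v. normal_decomp S g v \<longrightarrow> length w \<le> length v)"
  obtain w where "normal_decomp S g w"
    using garside_family by (auto simp: garside_family_def)
  then have "\<exists>w. ?P w"
    using ex_has_least_nat [of "normal_decomp S g" w length] by blast
  \<comment> \<open>Each word is at most as long as the other, so the lengths agree and uniqueness
    applies.\<close>
  moreover have "v = w" if "?P v" and "?P w" for v w
    using that by (intro normal_word_unique) (auto simp: normal_decomp_def intro: le_antisym)
  ultimately show "\<exists>!w. ?P w" by blast
qed

lemma
  assumes "w \<in> lists S"
  shows normal_word_N: "normal_word S (N w)"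
    and length_N: "length (N w) = length w"
    and prod_list_N: "prod_list (N w) = prod_list w"
proof -
  let ?v = "NF S (prod_list w)"
  have v: "normal_word S ?v" "prod_list ?v = prod_list w"
    using NF_minimal by (auto simp: normal_decomp_def)
  \<comment> \<open>Hence \<open>length w - length ?v\<close> does not truncate, and padding
    restores exactly the length of \<open>w\<close>.\<close>
  have "length ?v \<le> length w"
    using NF_minimal normal_decomp_short_exists [OF assms] le_trans by blast
  moreover have "prod_list (replicate n (1::'a)) = 1" for n
    by (induction n) auto
  ultimately show "normal_word S (N w)" "length (N w) = length w" "prod_list (N w) = prod_list w"
    using v one_mem by (auto simp: derived_normalisation_def Let_def normal_word_pad)
qed

text \<open>From here on \<open>N\<close> is handled through this characterisation, without
  unfolding \<open>NF\<close>.\<close>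

lemma N_eqI:
  assumes "w \<in> lists S" and "normal_word S v"
    and "length v = length w" and "prod_list v = prod_list w"
  shows "N w = v"
  using assms by (intro normal_word_unique) (auto simp: normal_word_N length_N prod_list_N)

lemma N_in_lists: "w \<in> lists S \<Longrightarrow> N w \<in> lists S"
  by (simp add: normal_word_N normal_word_letters)

lemma N_cong:
  "v \<in> lists S \<Longrightarrow> w \<in> lists S \<Longrightarrow> length v = length w \<Longrightarrow> prod_list v = prod_list w \<Longrightarrow> N v = N w"
  by (intro N_eqI) (auto simp: normal_word_N length_N prod_list_N)

lemma N_fixed_iff: "w \<in> lists S \<Longrightarrow> N w = w \<longleftrightarrow> normal_word S w"
  by (metis N_eqI normal_word_N)

lemma N_pair:
  assumes "a \<in> S" and "b \<in> S"
  obtains x y where "N [a, b] = [x, y]" "x \<in> S" "y \<in> S" "normal_pair S x y" "a * b = x * y"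
proof -
  have "length (N [a, b]) = 2" using assms by (simp add: length_N)
  then obtain x y where xy: "N [a, b] = [x, y]"
    by (auto simp: length_Suc_conv numeral_2_eq_2)
  with assms normal_word_N [of "[a, b]"] prod_list_N [of "[a, b]"] that [of x y]
  show ?thesis by simp
qed

lemma normalisation_N: "normalisation S N"
  unfolding normalisation_def
proof (intro conjI ballI impI)
  fix w assume w: "w \<in> lists S" "length w = 1"
  then show "N w = w" by (auto simp: N_fixed_iff length_Suc_conv)
next
  fix u v w assume "u \<in> lists S" "v \<in> lists S" "w \<in> lists S"
  \<comment> \<open>Replacing \<open>w\<close> by \<open>N w\<close> inside a word changes neither
    its length nor its value.\<close>
  then show "N (u @ N w @ v) = N (u @ w @ v)"
    by (intro N_cong) (auto simp: N_in_lists length_N prod_list_N simp del: in_lists_conv_set)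
qed (auto simp: N_in_lists length_N simp del: in_lists_conv_set)

section \<open>Normalisation by left-to-right passes\<close>

lemma normal_word_domino_pass:
  "a \<in> S \<Longrightarrow> normal_word S w \<Longrightarrow>
    normal_word S (domino_pass N a w) \<and> length (domino_pass N a w) = Suc (length w) \<and>
    prod_list (domino_pass N a w) = a * prod_list w"
proof (induction w arbitrary: a)
  case Nil
  then show ?case by simp
next
  case (Cons s w)
  then have s: "s \<in> S" and w: "normal_word S w"
    using normal_word_ConsD by blast+
  obtain x y where xy: "N [a, s] = [x, y]" "x \<in> S" "y \<in> S" "normal_pair S x y" "a * s = x * y"
    using N_pair Cons.prems(1) s by blast
  have IH: "normal_word S (domino_pass N y w)" "length (domino_pass N y w) = Suc (length w)"
    "prod_list (domino_pass N y w) = y * prod_list w"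
    using Cons.IH [OF xy(3) w] by auto
  have "normal_word S (x # domino_pass N y w)"
  proof (cases w)
    case Nil
    then show ?thesis using xy by simp
  next
    case (Cons t u)
    then have "t \<in> S" using w normal_word_ConsD by blast
    then obtain x' y' where xy': "N [y, t] = [x', y']" "y * t = x' * y'"
      using N_pair xy(3) by blast
    have "normal_pair S s t" using Cons Cons.prems(2) by simp
    \<comment> \<open>The tail of the result is normal by induction and begins with
      \<open>x'\<close>, so the junction \<open>x\<close>, \<open>x'\<close> is all that is
      missing.\<close>
    then have "normal_pair S x x'"
      using normal_pair_domino xy(4,5) xy'(2) by blast
    then show ?thesis using IH(1) Cons xy' xy(2) by simp
  qed
  then show ?case using IH xy by (simp add: mult.assoc [symmetric])
qed

lemma domino_pass_eq_apply_seq: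
  "a \<in> S \<Longrightarrow> w \<in> lists S \<Longrightarrow> domino_pass N a w = apply_seq N [1..<Suc (length w)] (a # w)"
proof (induction w arbitrary: a)
  case Nil
  then show ?case by (simp add: apply_seq_Nil)
next
  case (Cons s w)
  then obtain x y where xy: "N [a, s] = [x, y]" "y \<in> S"
    using N_pair by (metis Cons_in_lists_iff)
  \<comment> \<open>Position 1 treats the head pair; the others are the pass on the tail, shifted by
    one.\<close>
  have "[1..<Suc (length (s # w))] = 1 # map Suc [1..<Suc (length w)]"
    by (simp add: map_Suc_upt upt_conv_Cons del: upt_Suc)
  then have "apply_seq N [1..<Suc (length (s # w))] (a # s # w)
      = apply_seq N (map Suc [1..<Suc (length w)]) (x # y # w)"
    by (simp add: apply_seq_Cons apply_at_1 xy del: upt_Suc)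
  also have "\<dots> = x # apply_seq N [1..<Suc (length w)] (y # w)"
    by (intro apply_seq_map_Suc) auto
  also have "\<dots> = domino_pass N a (s # w)"
    using Cons xy by simp
  finally show ?case by simp
qed

lemma apply_seq_domino:
  assumes "a \<in> S" and "w \<in> lists S"
  shows "apply_seq N [1..<Suc (length w)] (a # N w) = N (a # w)"
proof -
  have "apply_seq N [1..<Suc (length w)] (a # N w) = domino_pass N a (N w)"
    using assms by (simp add: domino_pass_eq_apply_seq N_in_lists length_N
        del: upt_Suc in_lists_conv_set)
  also have "\<dots> = N (a # w)"
    using assms normal_word_domino_pass [of a "N w"]
    by (intro N_eqI [symmetric]) (auto simp: normal_word_N length_N prod_list_N)
  finally show ?thesis .
qed

text \<open>The tail is normalised first, at shifted positions; one full pass then brings in the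
  head.\<close>

lemma N_eq_apply_seq:
  "w \<in> lists S \<Longrightarrow> \<exists>is. set is \<subseteq> {1..<length w} \<and> N w = apply_seq N is w"
proof (induction w)
  case Nil
  have "N [] = []" using length_N [of "[]"] by simp
  then show ?case by (intro exI [of _ "[]"]) (simp add: apply_seq_Nil)
next
  case (Cons a w)
  then obtain "is" where "is": "set is \<subseteq> {1..<length w}" "N w = apply_seq N is w"
    by auto
  then have "apply_seq N (map Suc is) (a # w) = a # N w"
    by (auto intro!: apply_seq_map_Suc)
  then have "N (a # w) = apply_seq N (map Suc is @ [1..<Suc (length w)]) (a # w)"
    using Cons.prems by (simp add: apply_seq_append apply_seq_domino del: upt_Suc One_nat_def)
  moreover have "set (map Suc is @ [1..<Suc (length w)]) \<subseteq> {1..<length (a # w)}"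
    using "is" by auto
  ultimately show ?case by blast
qed

section \<open>The quadratic property and class (4,3)\<close>

lemma quadratic_N: "quadratic S N"
  unfolding quadratic_def
proof (intro conjI ballI)
  fix w assume w: "w \<in> lists S"
  have "N w = w \<longleftrightarrow> (\<forall>x a b z. w = x @ [a, b] @ z \<longrightarrow> normal_pair S a b)"
    using w by (simp add: N_fixed_iff normal_word_def successively_iff_factors del: in_lists_conv_set)
  also have "\<dots> \<longleftrightarrow> (\<forall>x a b z. w = x @ [a, b] @ z \<longrightarrow> N [a, b] = [a, b])"
  proof -
    \<comment> \<open>Being a factor of \<open>w\<close> puts \<open>a\<close> and \<open>b\<close>
      in \<open>S\<close>, as \<open>N_fixed_iff\<close> requires.\<close>
    have "N [a, b] = [a, b] \<longleftrightarrow> normal_pair S a b" if "w = x @ [a, b] @ z" for x a b z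
      using w that by (simp add: N_fixed_iff)
    then show ?thesis by blast
  qed
  also have "\<dots> \<longleftrightarrow> (\<forall>x y z. w = x @ y @ z \<and> length y = 2 \<longrightarrow> N y = y)"
  proof (intro iffI allI impI)
    fix x y z
    assume *: "\<forall>x a b z. w = x @ [a, b] @ z \<longrightarrow> N [a, b] = [a, b]"
      and y: "w = x @ y @ z \<and> length y = 2"
    from y obtain a b where "y = [a, b]"
      by (auto simp: numeral_2_eq_2 length_Suc_conv)
    with * y show "N y = y" by blast
  next
    fix x a b z
    assume "\<forall>x y z. w = x @ y @ z \<and> length y = 2 \<longrightarrow> N y = y" and "w = x @ [a, b] @ z"
    then show "N [a, b] = [a, b]"
      by (metis length_Cons list.size(3) numeral_2_eq_2)
  qed
  finally show "N w = w \<longleftrightarrow> (\<forall>x y z. w = x @ y @ z \<and> length y = 2 \<longrightarrow> N y = y)" .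
qed (rule N_eq_apply_seq)

lemma class_4_3_N: "class_4_3 S N"
proof -
  \<comment> \<open>The first 2 normalises the tail; the remaining 1, 2 is the pass of the head
    through it.\<close>
  have N_212: "apply_seq N [2, 1, 2] [a, b, c] = N [a, b, c]"
    if "a \<in> S" "b \<in> S" "c \<in> S" for a b c
  proof -
    have upt: "[1..<Suc (length [b, c])] = [1, 2]" by (simp add: upt_rec)
    have "apply_seq N [1, 2] (a # N [b, c]) = N [a, b, c]"
      using apply_seq_domino [of a "[b, c]"] that unfolding upt by simp
    moreover have "apply_at N 2 [a, b, c] = a # N [b, c]"
      by (simp add: apply_at_def)
    ultimately show ?thesis
      by (simp add: apply_seq_Cons)
  qed
  have N_1212: "apply_seq N [1, 2, 1, 2] [a, b, c] = N [a, b, c]"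
    if "a \<in> S" "b \<in> S" "c \<in> S" for a b c
  proof -
    obtain x y where xy: "N [a, b] = [x, y]" "x \<in> S" "y \<in> S" "a * b = x * y"
      using N_pair \<open>a \<in> S\<close> \<open>b \<in> S\<close> by blast
    \<comment> \<open>After the initial 1, the rest is the 212 case for \<open>[x, y, c]\<close>, a
      word with the same value as \<open>[a, b, c]\<close>.\<close>
    have "apply_seq N [1, 2, 1, 2] [a, b, c] = N [x, y, c]"
      using N_212 [of x y c] xy \<open>c \<in> S\<close> by (simp add: apply_seq_Cons apply_at_1)
    also have "\<dots> = N [a, b, c]"
      using xy that by (intro N_cong) (auto simp: mult.assoc [symmetric])
    finally show ?thesis .
  qed
  show ?thesis
    unfolding class_4_3_def
    by (auto simp: numeral_3_eq_3 length_Suc_conv N_212 N_1212 simp del: One_nat_def)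
qed

end

theorem proposition6p1p7:
  fixes S :: "'a::monoid_mult set"
  assumes left_cancellative: "\<And>a b c :: 'a. a * b = a * c \<Longrightarrow> b = c"
    and no_invertible: "\<And>a b :: 'a. a * b = 1 \<Longrightarrow> b * a = 1 \<Longrightarrow> a = 1"
    and garside: "garside_family S"
  shows "normalisation S (derived_normalisation S) \<and>
    quadratic S (derived_normalisation S) \<and>
    class_4_3 S (derived_normalisation S)"
proof -
  interpret garside S
    using assms by unfold_locales
  show ?thesis
    using normalisation_N quadratic_N class_4_3_N by blast
qed

end
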